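(* Let $n\ge1$. Every symmetric rational tropical function $r\in\operatorname{RTrop}[x_1,\ldots,x_n]$ can be written as a rational tropical function in the elementary symmetric tropical polynomials $e_1,\ldots,e_n$; that is, there is $R\in\operatorname{RTrop}[y_1,\ldots,y_n]$ such that $r(x)=R(e_1(x),\ldots,e_n(x))$ for all $x\in\mathbb{R}^n$.
   Context: Tropical arithmetic: $a\oplus b=\min(a,b)$, $a\odot b=a+b$; $b^{-1}$ denotes $-b$, and $x^i$ is the tropical power (ordinary $i\cdot x$). A tropical polynomial expression in $x_1,\ldots,x_n$ is a finite (nonempty) tropical sum $\bigoplus_{j=1}^m a_j\odot x_1^{i_1^j}\odot\cdots\odot x_n^{i_n^j}$ with $a_j\in\mathbb{R}$, $i_k^j\in\mathbb{Z}$; it defines the function $x\mapsto\min_j(a_j+i_1^jx_1+\cdots+i_n^jx_n)$ on $\mathbb{R}^n$. A tropical rational expression is a tropical quotient $p\odot q^{-1}$ (ordinary difference $p-q$) of tropical polynomial expressions $p,q$. $\operatorname{RTrop}[x_1,\ldots,x_n]$, the semiring of rational tropical functions, consists of tropical rational expressions modulo defining the same function $\mathbb{R}^n\to\mathbb{R}$. A rational tropical function $r$ is symmetric if $r(x_1,\ldots,x_n)=r(x_{\pi(1)},\ldots,x_{\pi(n)})$ for all $\pi\in S_n$. The elementary symmetric tropical polynomials are $e_k=\bigoplus_{\pi\in S_n}x_{\pi(1)}\odot\cdots\odot x_{\pi(k)}$, $1\le k\le n$. *)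

theory Defs
  imports Complex_Main "HOL-Combinatorics.Permutations"
begin

text \<open>
  A point of \<open>\<real>\<^sup>n\<close> is represented by a function \<open>x :: nat \<Rightarrow> real\<close> of which only the coordinates
  \<open>x 1, \<dots>, x n\<close> are used. The elements of \<open>RTrop n\<close> ignore the remaining coordinates
  (lemma \<open>RTrop_cong\<close>), as do \<open>elem_trop n k\<close> for \<open>k \<le> n\<close>, so quantifying over all \<open>x :: nat \<Rightarrow> real\<close> amounts to quantifying over \<open>\<real>\<^sup>n\<close>.
\<close>

text \<open>
  A tropical polynomial expression is the list of its monomials \<open>(a\<^sub>j, i\<^sup>j)\<close>, with coefficient
  \<open>a\<^sub>j\<close> and integer exponents \<open>i\<^sup>j 1, \<dots>, i\<^sup>j n\<close>; the list is required to be nonempty.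
\<close>

type_synonym trop_poly = "(real \<times> (nat \<Rightarrow> int)) list"

definition monomial_eval :: "nat \<Rightarrow> real \<times> (nat \<Rightarrow> int) \<Rightarrow> (nat \<Rightarrow> real) \<Rightarrow> real" where
  "monomial_eval n m x = fst m + (\<Sum>k = 1..n. of_int (snd m k) * x k)"

definition trop_poly_eval :: "nat \<Rightarrow> trop_poly \<Rightarrow> (nat \<Rightarrow> real) \<Rightarrow> real" where
  "trop_poly_eval n p x = Min ((\<lambda>m. monomial_eval n m x) ` set p)"

text \<open>
  Rational expressions modulo defining the same function are identified with the functions
  they define.
\<close>

definition RTrop :: "nat \<Rightarrow> ((nat \<Rightarrow> real) \<Rightarrow> real) set" where
  "RTrop n = {(\<lambda>x. trop_poly_eval n p x - trop_poly_eval n q x) | p q. p \<noteq> [] \<and> q \<noteq> []}"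

definition trop_symmetric :: "nat \<Rightarrow> ((nat \<Rightarrow> real) \<Rightarrow> real) \<Rightarrow> bool" where
  "trop_symmetric n r \<longleftrightarrow> (\<forall>\<pi>. \<pi> permutes {1..n} \<longrightarrow> (\<forall>x. r x = r (\<lambda>i. x (\<pi> i))))"

definition elem_trop :: "nat \<Rightarrow> nat \<Rightarrow> (nat \<Rightarrow> real) \<Rightarrow> real" where
  "elem_trop n k x = Min ((\<lambda>\<pi>. \<Sum>i = 1..k. x (\<pi> i)) ` {\<pi>. \<pi> permutes {1..n}})"

lemma RTrop_cong:
  assumes "r \<in> RTrop n" and "\<And>k. k \<in> {1..n} \<Longrightarrow> x k = y k"
  shows "r x = r y"
proof -
  have "(\<Sum>k = 1..n. of_int (c k) * x k) = (\<Sum>k = 1..n. of_int (c k) * y k)" for c :: "nat \<Rightarrow> int"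
    by (rule sum.cong) (use assms(2) in auto)
  then have "(\<lambda>m. monomial_eval n m x) = (\<lambda>m. monomial_eval n m y)"
    by (simp add: monomial_eval_def)
  then have "trop_poly_eval n p x = trop_poly_eval n p y" for p
    unfolding trop_poly_eval_def by (rule arg_cong)
  then show ?thesis
    using assms(1) by (auto simp: RTrop_def)
qed

end

theory Submission
  imports Defs
begin

text \<open>
  On a weakly increasing point \<open>x\<close>, the function \<open>e\<^sub>k\<close> takes the value \<open>x\<^sub>1 + \<dots> + x\<^sub>k\<close>, so that
  \<open>x\<^sub>k = e\<^sub>k - e\<^sub>k\<^sub>-\<^sub>1\<close> with \<open>e\<^sub>0 = 0\<close>. Since \<open>r\<close> and the \<open>e\<^sub>k\<close> are symmetric and every point can be
  sorted, \<open>r(x) = r(e\<^sub>1, e\<^sub>2 - e\<^sub>1, \<dots>, e\<^sub>n - e\<^sub>n\<^sub>-\<^sub>1)\<close> for all \<open>x\<close>; this substitution replaces the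
  exponents \<open>i\<^sub>k\<close> of a monomial by \<open>i\<^sub>k - i\<^sub>k\<^sub>+\<^sub>1\<close>.
\<close>

lemma ex_sorting_permutation:
  fixes x :: "nat \<Rightarrow> 'a :: linorder"
  shows "\<exists>\<pi>. \<pi> permutes {1..n} \<and> mono_on {1..n} (\<lambda>i. x (\<pi> i))"
proof -
  define xs where "xs = sort_key x [1..<Suc n]"
  \<comment> \<open>\<open>xs\<close> is indexed from 0 and points from 1, hence the shift;
    \<open>permutes\<close> demands the identity outside \<open>{1..n}\<close>.\<close>
  define \<pi> where "\<pi> i = (if i \<in> {1..n} then xs ! (i - 1) else i)" for i
  have len: "length xs = n" and set: "set xs = {1..n}" and dist: "distinct xs"
    and sorted: "sorted (map x xs)"
    by (auto simp: xs_def simp del: upt_Suc)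
  have "bij_betw (\<lambda>i. i - 1) {1..n} {..<n}"
    by (rule bij_betw_byWitness[where f' = Suc]) auto
  moreover have "bij_betw ((!) xs) {..<n} {1..n}"
    by (rule bij_betw_nth) (simp_all add: dist len set)
  ultimately have "bij_betw ((!) xs \<circ> (\<lambda>i. i - 1)) {1..n} {1..n}"
    by (rule bij_betw_trans)
  then have "bij_betw \<pi> {1..n} {1..n}"
    by (rule iffD2[OF bij_betw_cong, rotated]) (simp add: \<pi>_def)
  then have "\<pi> permutes {1..n}"
    by (rule bij_imp_permutes) (auto simp: \<pi>_def)
  moreover have "x (\<pi> i) \<le> x (\<pi> j)" if "i \<in> {1..n}" "j \<in> {1..n}" "i \<le> j" for i j
    using sorted_nth_mono[OF sorted, of "i - 1" "j - 1"] that len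
    by (simp add: \<pi>_def nth_map diff_le_mono)
  ultimately show ?thesis
    by (blast intro: mono_onI)
qed

text \<open>Put \<open>k = card A\<close>. After cancelling the common part of \<open>{1..k}\<close>
  and \<open>A\<close>, the two remainders have the same size, and \<open>x k\<close> separates
  them: it bounds the values on \<open>{1..k} - A\<close> from above and those on
  \<open>A - {1..k}\<close> from below.\<close>

lemma sum_initial_segment_le:
  fixes x :: "nat \<Rightarrow> real"
  assumes "mono_on {1..n} x" and "A \<subseteq> {1..n}"
  shows "sum x {1..card A} \<le> sum x A"
proof -
  define k where "k = card A"
  have fin: "finite A"
    using assms(2) finite_subset by blast
  have "k \<le> n"
    using card_mono[OF _ assms(2)] by (simp add: k_def)
  have card_eq: "card ({1..k} - A) = card (A - {1..k})"
    using card_Diff_subset_Int[of "{1..k}" A] card_Diff_subset_Int[of A "{1..k}"] fin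
    by (simp add: k_def Int_commute)
  have "sum x ({1..k} - A) \<le> of_nat (card ({1..k} - A)) * x k"
    by (rule sum_bounded_above) (use \<open>k \<le> n\<close> in \<open>auto intro!: mono_onD[OF assms(1)]\<close>)
  also have "\<dots> = of_nat (card (A - {1..k})) * x k"
    by (simp only: card_eq)
  also have "\<dots> \<le> sum x (A - {1..k})"
  \<comment> \<open>Monotonicity says nothing about \<open>x 0\<close>, so \<open>k = 0\<close> is
    separate; there \<open>A\<close> is empty.\<close>
  proof (cases "k = 0")
    case True
    then show ?thesis
      using fin by (simp add: k_def)
  next
    case False
    show ?thesis
    proof (rule sum_bounded_below)
      fix i
      assume "i \<in> A - {1..k}"
      then have "i \<in> {1..n}" and "k \<le> i"
        using assms(2) by auto
      then show "x k \<le> x i"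
        using False \<open>k \<le> n\<close> by (intro mono_onD[OF assms(1)]) auto
    qed
  qed
  finally have "sum x ({1..k} - A) \<le> sum x (A - {1..k})" .
  then show ?thesis
    using sum.Int_Diff[of "{1..k}" x A] sum.Int_Diff[of A x "{1..k}"] fin
    by (simp add: k_def Int_commute)
qed

text \<open>The identity attains the minimum, and every permutation sums \<open>x\<close> over some
  \<open>k\<close>-element subset of \<open>{1..n}\<close>.\<close>

lemma elem_trop_mono_on:
  assumes "mono_on {1..n} x" and "k \<le> n"
  shows "elem_trop n k x = sum x {1..k}"
  unfolding elem_trop_def
proof (rule Min_eqI)
  show "finite ((\<lambda>\<pi>. \<Sum>i = 1..k. x (\<pi> i)) ` {\<pi>. \<pi> permutes {1..n}})"
    by (simp add: finite_permutations)
next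
  have "id permutes {1..n}"
    by (rule permutes_id)
  then show "sum x {1..k} \<in> (\<lambda>\<pi>. \<Sum>i = 1..k. x (\<pi> i)) ` {\<pi>. \<pi> permutes {1..n}}"
    by (intro image_eqI[where x = id]) simp_all
next
  fix s
  assume "s \<in> (\<lambda>\<pi>. \<Sum>i = 1..k. x (\<pi> i)) ` {\<pi>. \<pi> permutes {1..n}}"
  then obtain \<pi> where \<pi>: "\<pi> permutes {1..n}" and s: "s = (\<Sum>i = 1..k. x (\<pi> i))"
    by blast
  have inj: "inj_on \<pi> {1..k}"
    using permutes_inj[OF \<pi>] by (rule inj_on_subset) simp
  have "\<pi> ` {1..k} \<subseteq> {1..n}"
    using permutes_image[OF \<pi>] assms(2) by auto
  from sum_initial_segment_le[OF assms(1) this] show "sum x {1..k} \<le> s"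
    by (simp add: s card_image[OF inj] sum.reindex[OF inj] del: One_nat_def)
qed

text \<open>Left composition with \<open>\<pi>\<close> maps the permutations of
  \<open>{1..n}\<close> onto themselves, so it only reindexes the minimum.\<close>

lemma trop_symmetric_elem_trop: "trop_symmetric n (elem_trop n k)"
  unfolding trop_symmetric_def
proof (intro allI impI)
  fix \<pi> and x :: "nat \<Rightarrow> real"
  assume "\<pi> permutes {1..n}"
  then have "(\<lambda>\<sigma>. \<pi> \<circ> \<sigma>) ` {\<sigma>. \<sigma> permutes {1..n}} = {\<sigma>. \<sigma> permutes {1..n}}"
    by (metis image_compose_permutations_left setcompr_eq_image)
  then have "elem_trop n k x =
      Min ((\<lambda>\<sigma>. \<Sum>i = 1..k. x (\<sigma> i)) ` (\<lambda>\<sigma>. \<pi> \<circ> \<sigma>) ` {\<sigma>. \<sigma> permutes {1..n}})"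
    by (simp only: elem_trop_def)
  then show "elem_trop n k x = elem_trop n k (\<lambda>i. x (\<pi> i))"
    by (simp only: elem_trop_def image_image comp_apply)
qed

lemma summation_by_parts:
  fixes c y :: "nat \<Rightarrow> 'a :: comm_ring"
  shows "(\<Sum>k = 1..n. c k * (y k - y (k - 1))) =
    (\<Sum>k = 1..n. (c k - c (k + 1)) * y k) + c (n + 1) * y n - c 1 * y 0"
  by (induction n) (simp_all add: algebra_simps)

text \<open>The exponent at \<open>n + 1\<close> counts as 0, because \<open>snd m\<close> is
  arbitrary beyond \<open>n\<close>.\<close>

definition difference_monomial :: "nat \<Rightarrow> real \<times> (nat \<Rightarrow> int) \<Rightarrow> real \<times> (nat \<Rightarrow> int)" where
  "difference_monomial n m =
    (fst m, \<lambda>k. snd m k - (if k < n then snd m (k + 1) else 0))"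

lemma monomial_eval_difference:
  assumes "y 0 = 0"
  shows "monomial_eval n m (\<lambda>k. y k - y (k - 1)) = monomial_eval n (difference_monomial n m) y"
proof -
  \<comment> \<open>With this cut-off the boundary term \<open>c (n + 1) * y n\<close> of the
    summation by parts vanishes; the other one vanishes by \<open>y 0 = 0\<close>.\<close>
  define c where "c k = (if k \<le> n then real_of_int (snd m k) else 0)" for k
  have "(\<Sum>k = 1..n. of_int (snd m k) * (y k - y (k - 1))) = (\<Sum>k = 1..n. c k * (y k - y (k - 1)))"
    by (rule sum.cong) (auto simp: c_def)
  also have "\<dots> = (\<Sum>k = 1..n. (c k - c (k + 1)) * y k)"
    using assms by (subst summation_by_parts) (simp add: c_def)
  also have "\<dots> = (\<Sum>k = 1..n. of_int (snd (difference_monomial n m) k) * y k)"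
    by (rule sum.cong) (auto simp: c_def difference_monomial_def)
  finally show ?thesis
    by (simp add: monomial_eval_def difference_monomial_def)
qed

text \<open>The substitution acts on each monomial separately and so commutes with the minima. The
  condition on \<open>y 0\<close> turns the first difference into \<open>y 1\<close>.\<close>

lemma RTrop_difference_substitution:
  assumes "r \<in> RTrop n"
  shows "\<exists>R \<in> RTrop n. \<forall>y. y 0 = 0 \<longrightarrow> R y = r (\<lambda>k. y k - y (k - 1))"
proof -
  from assms obtain p q where pq: "p \<noteq> []" "q \<noteq> []"
    and r: "r = (\<lambda>x. trop_poly_eval n p x - trop_poly_eval n q x)"
    by (auto simp: RTrop_def)
  let ?d = "map (difference_monomial n)"
  have "trop_poly_eval n (?d p) y = trop_poly_eval n p (\<lambda>k. y k - y (k - 1))" if "y 0 = 0" for p y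
    by (simp only: trop_poly_eval_def set_map image_image monomial_eval_difference[of y, OF that])
  moreover have "(\<lambda>y. trop_poly_eval n (?d p) y - trop_poly_eval n (?d q) y) \<in> RTrop n"
    unfolding RTrop_def using pq by blast
  ultimately show ?thesis
    using r by (intro bexI) auto
qed

theorem theorem4p2:
  fixes n :: nat and r :: "(nat \<Rightarrow> real) \<Rightarrow> real"
  assumes "n \<ge> 1"
    and "r \<in> RTrop n"
    and "trop_symmetric n r"
  shows "\<exists>R \<in> RTrop n. \<forall>x. r x = R (\<lambda>k. elem_trop n k x)"
proof -
  obtain R where R: "R \<in> RTrop n"
    and R_eq: "\<And>y. y 0 = 0 \<Longrightarrow> R y = r (\<lambda>k. y k - y (k - 1))"
    using RTrop_difference_substitution[OF assms(2)] by blast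
  have "r x = R (\<lambda>k. elem_trop n k x)" for x
  proof -
    obtain \<pi> where \<pi>: "\<pi> permutes {1..n}" and mono: "mono_on {1..n} (\<lambda>i. x (\<pi> i))"
      using ex_sorting_permutation by blast
    have elem: "elem_trop n k x = (\<Sum>i = 1..k. x (\<pi> i))" if "k \<le> n" for k
    proof -
      have "elem_trop n k x = elem_trop n k (\<lambda>i. x (\<pi> i))"
        using trop_symmetric_elem_trop \<pi> unfolding trop_symmetric_def by blast
      also have "\<dots> = (\<Sum>i = 1..k. x (\<pi> i))"
        by (rule elem_trop_mono_on[OF mono that])
      finally show ?thesis .
    qed
    have "r x = r (\<lambda>k. x (\<pi> k))"
      using assms(3) \<pi> unfolding trop_symmetric_def by blast
    \<comment> \<open>The two points need to agree only on \<open>{1..n}\<close>. At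
      \<open>k = 1\<close> the subtracted \<open>elem_trop n 0 x\<close> is an empty sum, hence 0;
      this also gives the condition of \<open>R_eq\<close> below.\<close>
    also have "\<dots> = r (\<lambda>k. elem_trop n k x - elem_trop n (k - 1) x)"
    proof (rule RTrop_cong[OF assms(2)])
      fix k
      assume "k \<in> {1..n}"
      then obtain j where "k = Suc j" "Suc j \<le> n"
        by (cases k) auto
      then show "x (\<pi> k) = elem_trop n k x - elem_trop n (k - 1) x"
        by (simp add: elem)
    qed
    also have "\<dots> = R (\<lambda>k. elem_trop n k x)"
      by (rule R_eq[symmetric]) (simp add: elem)
    finally show ?thesis .
  qed
  with R show ?thesis
    by blast
qed

end
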